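(* As $n\to\infty$, \[ \frac{D_n-\mu\log n}{\sqrt{\log n}}\ \xrightarrow{d}\ \mathrm{Normal}(0,\sigma^2),\qquad \mu=\frac1{\zeta(2)}=\frac{6}{\pi^2},\quad \sigma^2=\frac{2\zeta(3)}{\zeta(2)^3}. \]
   Context: $D_n$ is the absorption time at state 1 of the continuous-time Markov chain on $\{1,2,\dots\}$ started at $n$ that jumps from $m$ to $i$ at rate $1/(m-i)$ for $1\le i\le m-1$ (equivalently, the height of a uniformly random leaf in the continuous-time critical beta-splitting tree). $\zeta$ is the Riemann zeta function. *)

theory Defs
  imports "HOL-Probability.Probability"
begin

definition zeta_real :: "real \<Rightarrow> real" where
  "zeta_real s = (\<Sum>k. 1 / (real (Suc k)) powr s)"

definition bs_rate :: "nat \<Rightarrow> real" where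
  "bs_rate m = (\<Sum>i\<in>{1..<m}. 1 / real (m - i))"

text \<open>Jump distribution of the embedded chain from state m (m \<ge> 2):
  P(m \<rightarrow> i) = (1/(m-i)) / bs_rate m for 1 \<le> i \<le> m-1.\<close>
definition bs_jump :: "nat \<Rightarrow> nat pmf" where
  "bs_jump m = embed_pmf (\<lambda>i. if 1 \<le> i \<and> i < m then (1 / real (m - i)) / bs_rate m else 0)"

text \<open>Law of the absorption time started at m, given the laws L i of the absorption
  times started at states i < m: an Exp(bs_rate m) holding time plus an independent
  absorption time from the state the chain jumps to.\<close>
definition bs_step :: "nat \<Rightarrow> (nat \<Rightarrow> real measure) \<Rightarrow> real measure" where
  "bs_step m L = convolution (density lborel (exponential_density (bs_rate m)))
                              (measure_pmf (bs_jump m) \<bind> L)"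

text \<open>bs_laws k gives the laws of D_1, ..., D_(k+1) (D_1 = 0, absorbed immediately).\<close>
primrec bs_laws :: "nat \<Rightarrow> nat \<Rightarrow> real measure" where
  "bs_laws 0 = (\<lambda>_. return borel 0)"
| "bs_laws (Suc k) = (bs_laws k)(k + 2 := bs_step (k + 2) (bs_laws k))"

text \<open>Law of D_n, the absorption time at 1 of the chain started at n (n \<ge> 1).\<close>
definition D_law :: "nat \<Rightarrow> real measure" where
  "D_law n = bs_laws n n"

end

theory Submission
  imports Defs "HOL-Real_Asymp.Real_Asymp"
begin

text \<open>
  The characteristic function $\varphi_{n+1}$ of $D_{n+1}$ satisfies
  $(H_n - it)\,\varphi_{n+1} = \sum_{k=1}^n \varphi_{n+1-k}/k$ with $H_n$ the harmonic numbers.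
  An approximate solution is $f_n = e^{z H_n}$: writing $d_k = H_n - H_{n-k}$, the sums
  $\sum_k d_k/k$ and $\sum_k d_k^2/k$ have closed forms tending to $\zeta(2)$ and $2\zeta(3)$ with error
  $O(H_n/n)$, and $\sum_k d_k^3/k$ is bounded. Hence the choice
  $z = it/\zeta(2) - t^2\zeta(3)/\zeta(2)^3$ solves the recursion up to
  $O(|t| H_n/n + |t|^3)$. A comparison principle turns this into
  $|f_n - \varphi_{n+1}(t)| = O(|t| + |t|^3 H_n)$, which tends to $0$ for $t$ of order
  $1/\sqrt{\log n}$, and Levy's continuity theorem applies.
\<close>

section \<open>Harmonic sums\<close>

text \<open>The eigenvalue comes from the large-state limit. On n^z the sum of (f(n) - f(n-k))/k
  acts like multiplication by the integral of (1 - (1-x)^z)/x over (0,1), which is psi(1+z) + gamma.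
  Replacing log n by H_n in n^z = e^{z log n} costs nothing asymptotically and makes the increments
  obey exact recursions in n. The obstacle is the neighbourhood of the absorbing state: there the
  approximation is off by order |t| however large the starting state is. The comparison function 1 -
  1/(n+1) shows that these local errors contribute O(|t|) in total. The uniform part of the error
  accumulates over a time of order log n. An error of order t^2 would survive this accumulation when
  t is of order 1/sqrt(log n), an error of order |t|^3 does not. Hence the first two moments of the
  increments are needed with their limits, and the third only with a bound.\<close>

lemma sum_inverse_harm: "(\<Sum>k=Suc 0..n. 1 / real k) = harm n"
  by (simp add: harm_def inverse_eq_divide)

lemma sum_inverse_rev:
  "(\<Sum>k=1..n. 1 / real (n + 1 - k)) = harm n"
proof -
  have "(\<Sum>k=1..n. 1 / real (n + 1 - k)) = (\<Sum>k=1..n. 1 / real k)"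
    by (rule sum.reindex_bij_witness[of _ "\<lambda>k. n + 1 - k" "\<lambda>k. n + 1 - k"]) auto
  then show ?thesis by (simp add: harm_def inverse_eq_divide)
qed

section \<open>Exact recursions for power sums of harmonic increments\<close>

lemma harm_diff_nonneg: "0 \<le> harm n - (harm (n - k) :: real)"
  using harm_mono[of "n - k" n, where 'a = real] by simp

text \<open>The correction has a factor \<open>k\<close>, which cancels the weight
  \<open>1/k\<close> in the moment sums. What remains depends on \<open>Suc n - k\<close> and can be
  summed after reversal; this drives the inductions on \<open>n\<close> below.\<close>

lemma harm_diff_Suc:
  assumes "k \<le> n"
  shows "harm (Suc n) - harm (Suc n - k) =
    harm n - (harm (n - k) :: real) - real k / (real (Suc n) * real (Suc n - k))"
proof -
  have "harm (Suc n - k) = (harm (n - k) :: real) + 1 / real (Suc n - k)"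
    using assms by (simp add: Suc_diff_le harm_Suc inverse_eq_divide)
  moreover have "1 / real (Suc n - k) - 1 / real (Suc n) = real k / (real (Suc n) * real (Suc n - k))"
    using assms by (simp add: field_simps of_nat_diff)
  ultimately show ?thesis by (simp add: harm_Suc inverse_eq_divide)
qed

text \<open>From n to n+1 the old terms lose H_n/(n+1) in total and the new term k = n+1 adds
  H_{n+1}/(n+1), a net gain of 1/(n+1)^2.\<close>

lemma sum_harm_diff_1:
  "(\<Sum>k=1..n. (harm n - harm (n - k)) / real k) = (\<Sum>k=1..n. 1 / real k ^ 2)"
proof (induction n)
  case (Suc n)
  have "(\<Sum>k=1..n. (harm (Suc n) - harm (Suc n - k)) / real k) =
      (\<Sum>k=1..n. (harm n - harm (n - k)) / real k - 1 / real (Suc n) * (1 / real (n + 1 - k)))"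
    by (intro sum.cong refl, subst harm_diff_Suc) (auto simp: diff_divide_distrib)
  also have "\<dots> = (\<Sum>k=1..n. (harm n - harm (n - k)) / real k) - harm n / real (Suc n)"
    by (subst sum_subtractf, subst sum_distrib_left[symmetric], subst sum_inverse_rev) simp
  finally have "(\<Sum>k=1..Suc n. (harm (Suc n) - harm (Suc n - k)) / real k) =
      (\<Sum>k=1..n. 1 / real k ^ 2) + (harm (Suc n) - harm n) / real (Suc n)"
    using Suc.IH by (simp add: harm_expand(1) diff_divide_distrib del: of_nat_Suc)
  then show ?case
    by (simp add: harm_Suc inverse_eq_divide power2_eq_square del: of_nat_Suc)
qed simp

lemma sum_rev_Suc:
  fixes f :: "nat \<Rightarrow> real"
  shows "(\<Sum>k=1..n. f (Suc n - k)) = (\<Sum>k=1..n. f k)"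
  by (rule sum.reindex_bij_witness[of _ "\<lambda>k. Suc n - k" "\<lambda>k. Suc n - k"]) auto

text \<open>Each summand is H_k^2 - H_{k-1}^2, because H_k - H_{k-1} = 1/k.\<close>

lemma harm_square_telescope:
  "(\<Sum>k=1..n. (harm k + harm (k - 1)) / real k) = (harm n :: real) ^ 2"
proof (induction n)
  case (Suc n)
  define J where "J = inverse (real (Suc n))"
  have "harm (Suc n) = harm n + J"
    by (simp add: harm_Suc J_def)
  with Suc.IH show ?case
    by (simp add: J_def[symmetric] divide_inverse algebra_simps power2_eq_square del: of_nat_Suc)
qed (simp add: harm_expand)

text \<open>The induction for the first moment, with a^2 - b^2 = (a - b)(a + b). The factor a + b
  survives the cancellation of \<open>k\<close>, and its sum is evaluated by telescoping
  squares.\<close>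

lemma sum_harm_diff_2:
  "(\<Sum>k=1..n. (harm n - harm (n - k)) ^ 2 / real k) = (\<Sum>k=1..n. harm k / real k ^ 2)"
proof (induction n)
  case (Suc n)
  define N where "N = real (Suc n)"
  have "(\<Sum>k=1..n. (harm (Suc n) - harm (Suc n - k)) ^ 2 / real k) =
      (\<Sum>k=1..n. (harm n - harm (n - k)) ^ 2 / real k
        - 1 / N * ((harm (Suc n) - harm (Suc n - k) + harm n - harm (Suc n - k - 1)) / real (Suc n - k)))"
  proof (intro sum.cong refl)
    fix k assume k: "k \<in> {1..n}"
    define a b where "a = harm (Suc n) - (harm (Suc n - k) :: real)"
      and "b = harm n - (harm (n - k) :: real)"
    have "a - b = - real k / (N * real (Suc n - k))"
      using harm_diff_Suc[of k n] k by (simp add: a_def b_def N_def)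
    then have "(a - b) / real k = - (1 / (N * real (Suc n - k)))"
      using k by simp
    moreover have "a ^ 2 - b ^ 2 = (a - b) * (a + b)"
      by (simp add: algebra_simps power2_eq_square)
    ultimately have "a ^ 2 / real k - b ^ 2 / real k = - (1 / (N * real (Suc n - k))) * (a + b)"
      by (metis diff_divide_distrib times_divide_eq_left)
    then have "a ^ 2 / real k = b ^ 2 / real k - 1 / N * ((a + b) / real (Suc n - k))"
      by simp
    moreover have "harm (Suc n) - harm (Suc n - k) + harm n - harm (Suc n - k - 1) = a + b"
      by (simp add: a_def b_def)
    ultimately show "(harm (Suc n) - harm (Suc n - k)) ^ 2 / real k = (harm n - harm (n - k)) ^ 2 / real k
        - 1 / N * ((harm (Suc n) - harm (Suc n - k) + harm n - harm (Suc n - k - 1)) / real (Suc n - k))"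
      by (simp only: a_def b_def)
  qed
  also have "\<dots> = (\<Sum>k=1..n. (harm n - harm (n - k)) ^ 2 / real k)
      - 1 / N * (\<Sum>k=1..n. (harm (Suc n) - harm k + harm n - harm (k - 1)) / real k)"
    by (subst sum_subtractf, subst sum_distrib_left[symmetric],
        subst sum_rev_Suc[of "\<lambda>j. (harm (Suc n) - harm j + harm n - harm (j - 1)) / real j" n]) simp
  also have "(\<Sum>k=1..n. (harm (Suc n) - harm k + harm n - harm (k - 1)) / real k) =
      (harm (Suc n) + harm n) * harm n - (harm n :: real) ^ 2"
  proof -
    have "(\<Sum>k=1..n. (harm (Suc n) - harm k + harm n - harm (k - 1)) / real k) =
        (\<Sum>k=1..n. (harm (Suc n) + harm n) * (1 / real k) - (harm k + harm (k - 1)) / real k)"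
      by (intro sum.cong refl) (simp add: diff_divide_distrib add_divide_distrib)
    then show ?thesis
      unfolding sum_subtractf sum_distrib_left[symmetric] harm_square_telescope
      by (simp add: sum_inverse_harm)
  qed
  finally have "(\<Sum>k=1..Suc n. (harm (Suc n) - harm (Suc n - k)) ^ 2 / real k) =
      (\<Sum>k=1..n. harm k / real k ^ 2) - 1 / N * ((harm (Suc n) + harm n) * harm n - harm n ^ 2)
        + harm (Suc n) ^ 2 / N"
    using Suc.IH by (simp add: N_def harm_expand(1) del: of_nat_Suc)
  \<comment> \<open>With H' = \<open>harm (Suc n)\<close> and H = \<open>harm n\<close>: H'^2 - (H'
    + H) H + H^2 = H' (H' - H).\<close>
  also have "\<dots> = (\<Sum>k=1..n. harm k / real k ^ 2) + harm (Suc n) * (harm (Suc n) - harm n) / N"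
    by (simp add: divide_inverse algebra_simps power2_eq_square)
  also have "harm (Suc n) - harm n = 1 / N"
    by (simp add: harm_Suc N_def inverse_eq_divide)
  finally show ?case by (simp add: N_def power2_eq_square del: of_nat_Suc)
qed simp

text \<open>Partial fractions: both halves are the same harmonic sum, read in opposite
  directions.\<close>

lemma sum_inverse_mult_rev:
  "(\<Sum>k=1..n. 1 / (real k * real (Suc n - k))) = 2 * harm n / real (Suc n)"
proof -
  have "(\<Sum>k=1..n. 1 / (real k * real (Suc n - k))) =
      (\<Sum>k=1..n. 1 / real (Suc n) * (1 / real k + 1 / real (n + 1 - k)))"
    by (intro sum.cong refl) (auto simp: field_simps of_nat_diff)
  also have "\<dots> = 2 * harm n / real (Suc n)"
    unfolding sum_distrib_left[symmetric] sum.distrib sum_inverse_rev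
    by (simp add: harm_def inverse_eq_divide)
  finally show ?thesis .
qed

text \<open>A finite form of Euler's identity $\sum_k H_k / k^2 = 2 \zeta(3)$.\<close>

lemma sum_harm_Euler:
  "(\<Sum>k=1..n. harm k / real k ^ 2) + (\<Sum>k=1..n. (harm n - harm (n - k)) / real k ^ 2) =
    2 * (\<Sum>k=1..n. 1 / real k ^ 3)"
proof (induction n)
  case (Suc n)
  define N where "N = real (Suc n)"
  have "(\<Sum>k=1..n. (harm (Suc n) - harm (Suc n - k)) / real k ^ 2) =
      (\<Sum>k=1..n. (harm n - harm (n - k)) / real k ^ 2 - 1 / N * (1 / (real k * real (Suc n - k))))"
    by (intro sum.cong refl, subst harm_diff_Suc)
       (auto simp: diff_divide_distrib power2_eq_square N_def)
  also have "\<dots> = (\<Sum>k=1..n. (harm n - harm (n - k)) / real k ^ 2) - 1 / N * (2 * harm n / N)"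
    by (subst sum_subtractf, subst sum_distrib_left[symmetric], subst sum_inverse_mult_rev)
       (simp add: N_def)
  finally have "(\<Sum>k=1..n. (harm (Suc n) - harm (Suc n - k)) / real k ^ 2) =
      2 * (\<Sum>k=1..n. 1 / real k ^ 3) - (\<Sum>k=1..n. harm k / real k ^ 2) - 1 / N * (2 * harm n / N)"
    using Suc.IH by simp
  moreover have "harm (Suc n) = harm n + 1 / N"
    by (simp add: harm_Suc N_def inverse_eq_divide)
  moreover have "N > 0" by (simp add: N_def)
  moreover define A B C :: real where "A = (\<Sum>k=1..n. (harm (Suc n) - harm (Suc n - k)) / real k ^ 2)"
    and "B = (\<Sum>k=1..n. harm k / real k ^ 2)" and "C = (\<Sum>k=1..n. 1 / real k ^ 3)"
  ultimately have "A = 2 * C - B - 1 / N * (2 * harm n / N)" "harm (Suc n) = harm n + 1 / N" "N > 0"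
    by simp_all
  \<comment> \<open>The old terms lose 2 H_n/N^2 and the two new terms add 2 H_{n+1}/N^2, leaving
    2/N^3.\<close>
  then have "B + harm (Suc n) / N ^ 2 + (A + harm (Suc n) / N ^ 2) = 2 * (C + 1 / N ^ 3)"
    by (simp add: add_divide_distrib eval_nat_numeral)
  then show ?case
    by (simp add: harm_expand(1) N_def A_def B_def C_def)
qed simp

text \<open>The increment consists of k reciprocals, each at most 1/(n+1-k), so partial fractions
  apply. This makes the correction in the finite Euler identity O(H_n/n).\<close>

lemma sum_harm_diff_remainder:
  "(\<Sum>k=1..n. (harm n - harm (n - k)) / real k ^ 2) \<le> 2 * harm n / real (Suc n)"
proof -
  have "(harm n - harm (n - k)) / real k ^ 2 \<le> 1 / (real k * real (Suc n - k))"
    if k: "k \<in> {1..n}" for k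
  proof -
    have "harm n - harm (n - k) = (\<Sum>j\<in>{n-k<..n}. 1 / real j)"
      unfolding harm_def inverse_eq_divide by (subst sum_diff[symmetric]) (auto intro!: sum.cong)
    also have "\<dots> \<le> real (card {n-k<..n}) * (1 / real (Suc n - k))"
      using k by (intro sum_bounded_above) (auto intro!: divide_left_mono)
    also have "\<dots> = real k / real (Suc n - k)"
      using k by simp
    finally have "(harm n - harm (n - k)) / real k ^ 2 \<le> real k / real (Suc n - k) / real k ^ 2"
      by (rule divide_right_mono) simp
    then show ?thesis using k by (simp add: power2_eq_square mult.commute del: of_nat_diff of_nat_Suc)
  qed
  then have "(\<Sum>k=1..n. (harm n - harm (n - k)) / real k ^ 2) \<le>
      (\<Sum>k=1..n. 1 / (real k * real (Suc n - k)))"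
    by (rule sum_mono)
  then show ?thesis by (simp only: sum_inverse_mult_rev)
qed

text \<open>The same induction with a^3 - b^3, but only an inequality: the loss of the old terms is
  bounded below by a telescoping sum that nearly cancels the new term H^3/N. The deficit is at most
  4 H^2/N^2, which is summable.\<close>

lemma sum_harm_diff_3_le:
  "(\<Sum>k=1..n. (harm n - harm (n - k)) ^ 3 / real k) \<le> (\<Sum>k=1..n. 4 * harm k ^ 2 / real k ^ 2)"
proof (induction n)
  case (Suc n)
  define N H where "N = real (Suc n)" and "H = (harm (Suc n) :: real)"
  have N: "N \<ge> 1" by (simp add: N_def)
  have Hn: "harm n = H - 1 / N"
    by (simp add: harm_Suc N_def H_def inverse_eq_divide)
  have H1: "H \<ge> 1"
    using harm_mono[of 1 "Suc n", where 'a = real] by (simp add: H_def harm_expand)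
  \<comment> \<open>The quotient (a^3 - b^3)/(a - b), weighted by 1/j and indexed by the reversed
    variable j = n + 1 - k.\<close>
  define g where "g j = ((H - harm j) ^ 2 + (H - harm j) * (harm n - harm (j - 1))
      + (harm n - harm (j - 1)) ^ 2) / real j" for j
  have "(\<Sum>k=1..n. (H - harm (Suc n - k)) ^ 3 / real k) =
      (\<Sum>k=1..n. (harm n - harm (n - k)) ^ 3 / real k - 1 / N * g (Suc n - k))"
  proof (intro sum.cong refl)
    fix k assume k: "k \<in> {1..n}"
    define a b where "a = harm (Suc n) - (harm (Suc n - k) :: real)"
      and "b = harm n - (harm (n - k) :: real)"
    have "a - b = - real k / (N * real (Suc n - k))"
      using harm_diff_Suc[of k n] k by (simp add: a_def b_def N_def)
    then have "(a - b) / real k = - (1 / (N * real (Suc n - k)))"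
      using k by simp
    moreover have "a ^ 3 - b ^ 3 = (a - b) * (a ^ 2 + a * b + b ^ 2)"
      by (simp add: algebra_simps eval_nat_numeral)
    ultimately have "a ^ 3 / real k - b ^ 3 / real k =
        - (1 / (N * real (Suc n - k))) * (a ^ 2 + a * b + b ^ 2)"
      by (metis diff_divide_distrib times_divide_eq_left)
    moreover have "g (Suc n - k) = (a ^ 2 + a * b + b ^ 2) / real (Suc n - k)"
      by (simp add: g_def a_def b_def H_def)
    ultimately have "a ^ 3 / real k = b ^ 3 / real k - 1 / N * g (Suc n - k)"
      by simp
    then show "(H - harm (Suc n - k)) ^ 3 / real k = (harm n - harm (n - k)) ^ 3 / real k
        - 1 / N * g (Suc n - k)"
      by (simp add: a_def b_def H_def)
  qed
  also have "\<dots> = (\<Sum>k=1..n. (harm n - harm (n - k)) ^ 3 / real k) - 1 / N * (\<Sum>j=1..n. g j)"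
    by (subst sum_subtractf, subst sum_distrib_left[symmetric], subst sum_rev_Suc) simp
  finally have step: "(\<Sum>k=1..n. (H - harm (Suc n - k)) ^ 3 / real k) =
      (\<Sum>k=1..n. (harm n - harm (n - k)) ^ 3 / real k) - 1 / N * (\<Sum>j=1..n. g j)" .
  have g_ge: "(H - harm (j - 1)) ^ 3 - (H - harm j) ^ 3 - 3 * H / N * (1 / real j) \<le> g j"
    if j: "j \<in> {1..n}" for j
  proof -
    \<comment> \<open>Taking \<open>H\<close> in place of \<open>harm n\<close> in \<open>c\<close>
      makes c - a = 1/j, so that the main part telescopes. The shift by 1/N costs at most (a +
      2c)/N, hence 3H/N.\<close>
    define a c where "a = H - harm j" and "c = H - harm (j - 1)"
    have ca: "c - a = 1 / real j"
      using j harm_Suc[of "j - 1", where 'a = real] by (simp add: a_def c_def inverse_eq_divide)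
    have "0 \<le> a" using j harm_mono[of j "Suc n", where 'a = real] by (simp add: a_def H_def)
    moreover have "c \<le> H" by (simp add: c_def harm_nonneg)
    moreover have "a \<le> c" using j ca by (simp add: algebra_simps)
    ultimately have "(a + 2 * c) / N \<le> 3 * H / N"
      using N by (intro divide_right_mono) auto
    then have "a ^ 2 + a * c + c ^ 2 - 3 * H / N \<le> a ^ 2 + a * c + c ^ 2 - (a + 2 * c) / N"
      by simp
    also have "\<dots> \<le> a ^ 2 + a * (c - 1 / N) + (c - 1 / N) ^ 2"
      by (simp add: power2_eq_square algebra_simps add_divide_distrib)
    finally have "(a ^ 2 + a * c + c ^ 2 - 3 * H / N) / real j
        \<le> (a ^ 2 + a * (c - 1 / N) + (c - 1 / N) ^ 2) / real j"
      by (rule divide_right_mono) simp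
    also have "\<dots> = g j" by (simp add: g_def a_def c_def Hn algebra_simps)
    finally have "(c - a) * (a ^ 2 + a * c + c ^ 2) - 3 * H / N * (1 / real j) \<le> g j"
      by (simp add: ca diff_divide_distrib)
    moreover have "(c - a) * (a ^ 2 + a * c + c ^ 2) = c ^ 3 - a ^ 3"
      by (simp add: algebra_simps eval_nat_numeral)
    ultimately show ?thesis by (simp add: a_def c_def)
  qed
  have tel: "(\<Sum>j=1..m. (H - harm (j - 1)) ^ 3 - (H - harm j) ^ 3) = H ^ 3 - (H - harm m) ^ 3" for m
    by (induction m) (simp_all add: harm_expand(1))
  have "(\<Sum>j=1..n. (H - harm (j - 1)) ^ 3 - (H - harm j) ^ 3 - 3 * H / N * (1 / real j))
      \<le> (\<Sum>j=1..n. g j)"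
    using g_ge by (rule sum_mono)
  also have "(\<Sum>j=1..n. (H - harm (j - 1)) ^ 3 - (H - harm j) ^ 3 - 3 * H / N * (1 / real j)) =
      H ^ 3 - (1 / N) ^ 3 - 3 * H / N * harm n"
    by (subst sum_subtractf, subst sum_distrib_left[symmetric], subst tel)
       (simp add: Hn sum_inverse_harm)
  finally have "1 / N * (H ^ 3 - (1 / N) ^ 3 - 3 * H / N * harm n) \<le> 1 / N * (\<Sum>j=1..n. g j)"
    using N by (intro mult_left_mono) auto
  \<comment> \<open>4 = 3 + 1: three from the shift, one from the telescoping endpoint, where H -
    H_n = 1/N is at most H.\<close>
  moreover have "H ^ 3 / N - 1 / N * (H ^ 3 - (1 / N) ^ 3 - 3 * H / N * harm n) \<le> 4 * H ^ 2 / N ^ 2"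
  proof -
    have "H ^ 3 / N - 1 / N * (H ^ 3 - (1 / N) ^ 3 - 3 * H / N * harm n)
        = ((1 / N) ^ 2 + 3 * H * harm n) / N ^ 2"
      by (simp add: divide_inverse algebra_simps eval_nat_numeral)
    also have "\<dots> \<le> (H ^ 2 + 3 * H * H) / N ^ 2"
    proof (intro divide_right_mono add_mono mult_left_mono power_mono)
      have "1 / N \<le> 1" using N by simp
      then show "1 / N \<le> H" using H1 by linarith
      show "harm n \<le> H" using N by (simp add: Hn)
    qed (use N H1 in auto)
    finally show ?thesis by (simp add: power2_eq_square)
  qed
  ultimately show ?case
    using Suc.IH step by (simp add: N_def[symmetric] H_def[symmetric] harm_expand(1) del: of_nat_Suc)
qed simp

section \<open>Limits and error bounds for the moment sums\<close>

lemma zeta_real_tail: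
  fixes p n :: nat
  assumes "p \<ge> 2" "n \<ge> 1"
  shows "(\<Sum>k=1..n. 1 / real k ^ p) \<le> zeta_real (real p)"
    and "zeta_real (real p) \<le> (\<Sum>k=1..n. 1 / real k ^ p) + 1 / real n"
proof -
  define s where "s m = (\<Sum>k=1..m. 1 / real k ^ p)" for m
  have eq: "1 / real (Suc k) powr real p = inverse (real (Suc k) ^ p)" for k
    by (simp add: powr_realpow inverse_eq_divide del: of_nat_Suc)
  have "summable (\<lambda>k. inverse (real (Suc k) ^ p))"
    using inverse_power_summable[OF assms(1), where 'a = real] by (subst summable_Suc_iff)
  then have "(\<lambda>m. \<Sum>k<m. inverse (real (Suc k) ^ p)) \<longlonglongrightarrow> zeta_real (real p)"
    unfolding zeta_real_def eq by (rule summable_LIMSEQ)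
  moreover have "(\<Sum>k<m. inverse (real (Suc k) ^ p)) = s m" for m
    by (induction m) (simp_all add: s_def inverse_eq_divide)
  ultimately have lim: "s \<longlonglongrightarrow> zeta_real (real p)" by simp
  have "s n \<le> s m" if "m \<ge> n" for m
    unfolding s_def using that by (intro sum_mono2) auto
  then show "(\<Sum>k=1..n. 1 / real k ^ p) \<le> zeta_real (real p)"
    using lim unfolding s_def[symmetric] by (intro LIMSEQ_le_const) auto
  \<comment> \<open>The extra \<open>- 1 / real m\<close> lets the induction close: each new term is
    at most 1/m - 1/(m+1).\<close>
  have "s m \<le> s n + 1 / real n - 1 / real m" if "m \<ge> n" for m
    using that
  proof (induction m rule: nat_induct_at_least)
    case (Suc m)
    define M where "M = real m"
    have M: "M \<ge> 1" using Suc.hyps assms(2) by (simp add: M_def)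
    have "1 / (M + 1) ^ p \<le> 1 / (M + 1) ^ 2"
      using M assms(1) by (intro divide_left_mono power_increasing) auto
    also have "\<dots> \<le> 1 / (M * (M + 1))"
      using M by (intro divide_left_mono) (auto simp: power2_eq_square)
    also have "\<dots> = 1 / M - 1 / (M + 1)"
      using M by (simp add: field_simps)
    finally have "1 / (M + 1) ^ p \<le> 1 / M - 1 / (M + 1)" .
    moreover have "s (Suc m) = s m + 1 / (M + 1) ^ p"
      by (simp add: s_def M_def add.commute)
    ultimately show ?case using Suc.IH by (simp add: M_def add.commute)
  qed simp
  then have "s m \<le> s n + 1 / real n" if "m \<ge> n" for m
    by (smt (verit, best) that of_nat_0_le_iff zero_le_divide_1_iff)
  then show "zeta_real (real p) \<le> (\<Sum>k=1..n. 1 / real k ^ p) + 1 / real n"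
    using lim unfolding s_def[symmetric] by (intro LIMSEQ_le_const2) auto
qed

lemma harm_le_ln: "n \<ge> 1 \<Longrightarrow> harm n \<le> ln (real n) + 1"
  using euler_mascheroni_sequence_decreasing[of 1 n] by (simp add: harm_expand)

lemma sum_harm_square_bounded:
  obtains B where "B \<ge> 0" "\<And>n. (\<Sum>k=1..n. 4 * harm k ^ 2 / real k ^ 2) \<le> B"
proof -
  define f where "f k = 4 * harm k ^ 2 / real k ^ 2" for k
  have "f \<in> O(\<lambda>k. 4 * (ln (real k) + 1) ^ 2 / real k ^ 2)"
    using harm_le_ln harm_nonneg[where 'a = real]
    by (intro bigoI[of _ 1] eventually_sequentiallyI[of 1])
       (auto simp: f_def intro!: divide_right_mono power_mono)
  \<comment> \<open>Any exponent strictly between -2 and -1 absorbs the logarithms and stays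
    summable.\<close>
  also have "(\<lambda>k. 4 * (ln (real k) + 1) ^ 2 / real k ^ 2) \<in> O(\<lambda>k. real k powr (-3/2))"
    by real_asymp
  finally have "f \<in> O(\<lambda>k. real k powr (-3/2))" .
  moreover have "summable (\<lambda>k. norm (real k powr (-3/2)))"
    by (simp add: summable_real_powr_iff)
  ultimately have "summable f"
    by (rule summable_comparison_test_bigo[rotated])
  moreover have "f k \<ge> 0" for k by (simp add: f_def)
  ultimately have "(\<Sum>k=1..n. f k) \<le> suminf f" "0 \<le> suminf f" for n
    by (auto intro!: sum_le_suminf suminf_nonneg)
  then show ?thesis using that[of "suminf f"] by (simp add: f_def)
qed

section \<open>The approximate eigenfunction\<close>

text \<open>Expanding around the larger point \<open>a\<close> gives the Taylor argument w = -z(a -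
  b) a nonnegative real part. The growth factor exp(Re w) of the remainder then combines with |exp(z
  a)| into |exp(z b)| \<le> 1, so no exponential is left. The 2 in the bound is
  \<open>fact 2\<close>.\<close>

lemma norm_exp_increment_le:
  fixes z :: complex and a b :: real
  assumes "Re z \<le> 0" "0 \<le> b" "b \<le> a"
  shows "norm (exp (z * a) - exp (z * b) - exp (z * a) * (z * of_real (a - b) - z ^ 2 / 2 * of_real ((a - b) ^ 2)))
    \<le> norm z ^ 3 / 2 * (a - b) ^ 3"
proof -
  define w where "w = - z * of_real (a - b)"
  have "exp (z * a) * exp w = exp (z * b)"
    by (simp add: w_def exp_add[symmetric] algebra_simps)
  moreover have "E - E * exp w - E * (z * d - z ^ 2 / 2 * d ^ 2) = - (E * (exp w - (1 + w + w ^ 2 / 2)))"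
    if "w = - z * d" for E d :: complex
    unfolding that by (simp add: algebra_simps power_mult_distrib)
  ultimately have "norm (exp (z * a) - exp (z * b) - exp (z * a) * (z * of_real (a - b) - z ^ 2 / 2 * of_real ((a - b) ^ 2)))
      = norm (exp (z * a) * (exp w - (1 + w + w ^ 2 / 2)))"
    unfolding of_real_power using w_def by (metis norm_minus_cancel)
  also have "\<dots> = exp (Re z * a) * norm (exp w - (\<Sum>k\<le>2. w ^ k / fact k))"
    by (simp add: norm_mult numeral_2_eq_2)
  also have "\<dots> \<le> exp (Re z * a) * (exp \<bar>Re w\<bar> * norm w ^ 3 / 2)"
    using Taylor_exp[of w 2] by (intro mult_left_mono) (simp_all add: eval_nat_numeral)
  also have "\<bar>Re w\<bar> = - Re z * (a - b)"
    using assms by (simp add: w_def abs_mult)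
  also have "norm w ^ 3 = norm z ^ 3 * (a - b) ^ 3"
    using assms by (simp add: w_def norm_mult power_mult_distrib del: of_real_diff)
  also have "exp (Re z * a) * (exp (- Re z * (a - b)) * (norm z ^ 3 * (a - b) ^ 3) / 2)
      = exp (Re z * b) * (norm z ^ 3 / 2 * (a - b) ^ 3)"
  proof -
    have "exp (Re z * a) * exp (- Re z * (a - b)) = exp (Re z * b)"
      by (simp add: exp_add[symmetric] algebra_simps)
    then show ?thesis by (simp only: mult.assoc[symmetric] times_divide_eq_right times_divide_eq_left)
  qed
  also have "\<dots> \<le> 1 * (norm z ^ 3 / 2 * (a - b) ^ 3)"
    using assms by (intro mult_right_mono) (auto simp: mult_nonpos_nonneg)
  finally show ?thesis by simp
qed


text \<open>The sum is minus the generator of the chain at state \<open>n + 1\<close>, where a jump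
  down by \<open>k\<close> has rate \<open>1/k\<close>. The Taylor bound for a single increment is
  summed with these rates.\<close>

lemma norm_generator_exp_harm_le:
  fixes z :: complex and n :: nat
  assumes "Re z \<le> 0"
  defines "A \<equiv> \<Sum>k=1..n. (harm n - harm (n - k)) / real k"
    and "Q \<equiv> \<Sum>k=1..n. (harm n - harm (n - k)) ^ 2 / real k"
    and "C \<equiv> \<Sum>k=1..n. (harm n - harm (n - k)) ^ 3 / real k"
  shows "norm ((\<Sum>k=1..n. (exp (z * of_real (harm n)) - exp (z * of_real (harm (n - k)))) / of_nat k)
      - exp (z * of_real (harm n)) * (z * of_real A - z ^ 2 / 2 * of_real Q)) \<le> norm z ^ 3 / 2 * C"
proof -
  define g where "g k = exp (z * of_real (harm n)) - exp (z * of_real (harm (n - k)))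
    - exp (z * of_real (harm n)) * (z * of_real (harm n - harm (n - k))
      - z ^ 2 / 2 * of_real ((harm n - harm (n - k)) ^ 2))" for k
  have alg: "x / k - w * (z * (a / k) - z ^ 2 / 2 * (b / k)) = (x - w * (z * a - z ^ 2 / 2 * b)) / k"
    for x k w a b :: complex
    by (simp add: diff_divide_distrib right_diff_distrib)
  have "(\<Sum>k=1..n. (exp (z * of_real (harm n)) - exp (z * of_real (harm (n - k)))) / of_nat k)
      - exp (z * of_real (harm n)) * (z * of_real A - z ^ 2 / 2 * of_real Q) = (\<Sum>k=1..n. g k / of_nat k)"
    unfolding A_def Q_def g_def of_real_sum sum_distrib_left sum_subtractf[symmetric]
      of_real_divide of_real_of_nat_eq alg ..
  also have "norm \<dots> \<le> (\<Sum>k=1..n. norm z ^ 3 / 2 * ((harm n - harm (n - k)) ^ 3 / real k))"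
  proof (rule sum_norm_le)
    fix k
    have "norm (g k) \<le> norm z ^ 3 / 2 * (harm n - harm (n - k)) ^ 3"
      unfolding g_def by (intro norm_exp_increment_le assms harm_nonneg harm_mono diff_le_self)
    then have "norm (g k) / real k \<le> norm z ^ 3 / 2 * (harm n - harm (n - k)) ^ 3 / real k"
      by (rule divide_right_mono) simp
    then show "norm (g k / of_nat k) \<le> norm z ^ 3 / 2 * ((harm n - harm (n - k)) ^ 3 / real k)"
      by (simp add: norm_divide)
  qed
  also have "\<dots> = norm z ^ 3 / 2 * C"
    by (simp add: C_def sum_distrib_left)
  finally show ?thesis .
qed

text \<open>The zeta tail is at most 1/n \<le> 2 H_n/(n+1). In the second moment this tail counts
  twice and the Euler remainder adds another 2, giving 6.\<close>

lemma harm_moment_errors: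
  assumes "n \<ge> 1"
  shows "\<bar>(\<Sum>k=1..n. (harm n - harm (n - k)) / real k) - zeta_real 2\<bar> \<le> 2 * harm n / real (Suc n)"
    and "\<bar>(\<Sum>k=1..n. (harm n - harm (n - k)) ^ 2 / real k) - 2 * zeta_real 3\<bar> \<le> 6 * harm n / real (Suc n)"
proof -
  have H: "harm n \<ge> (1 :: real)"
    using harm_mono[OF assms, where 'a = real] by (simp add: harm_expand)
  have "1 / real n \<le> 2 / real (Suc n)"
    using assms by (simp add: field_simps)
  also have "\<dots> \<le> 2 * harm n / real (Suc n)"
    using H by (intro divide_right_mono) auto
  finally have le: "1 / real n \<le> 2 * harm n / real (Suc n)" .
  show "\<bar>(\<Sum>k=1..n. (harm n - harm (n - k)) / real k) - zeta_real 2\<bar> \<le> 2 * harm n / real (Suc n)"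
    using zeta_real_tail[of 2 n] assms le by (subst sum_harm_diff_1) (simp add: abs_le_iff)
  have "0 \<le> (\<Sum>k=1..n. (harm n - harm (n - k)) / real k ^ 2)"
    by (intro sum_nonneg divide_nonneg_nonneg harm_diff_nonneg) auto
  moreover have "(\<Sum>k=1..n. 1 / real k ^ 3) \<le> zeta_real 3"
      "zeta_real 3 \<le> (\<Sum>k=1..n. 1 / real k ^ 3) + 1 / real n"
    using zeta_real_tail[of 3 n] assms by simp_all
  moreover have "6 * harm n / real (Suc n) = 2 * (2 * harm n / real (Suc n)) + 2 * harm n / real (Suc n)"
    by simp
  ultimately show "\<bar>(\<Sum>k=1..n. (harm n - harm (n - k)) ^ 2 / real k) - 2 * zeta_real 3\<bar>
      \<le> 6 * harm n / real (Suc n)"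
    using le sum_harm_Euler[of n] sum_harm_diff_remainder[of n]
    unfolding sum_harm_diff_2 abs_le_iff by linarith
qed

section \<open>Solving the eigenvalue equation and bounding the residual\<close>

lemma zeta_real_ge_1: "p \<ge> 2 \<Longrightarrow> zeta_real (real p) \<ge> 1"
  using zeta_real_tail(1)[of p 1] by simp

text \<open>The expansion $\lambda(z) = \zeta(2) z - \zeta(3) z^2 + O(z^3)$ of the eigenvalue belonging to
  $e^{z h}$ is solved for $\lambda(z) = it$ up to third order.\<close>

definition char_exponent :: "real \<Rightarrow> complex" where
  "char_exponent t = Complex (- (zeta_real 3 / zeta_real 2 ^ 3) * t ^ 2) (t / zeta_real 2)"

text \<open>The real part of the exponent is chosen to cancel the t^2 term y/x^2 - s x. Only a t^3
  and a t^4 term remain, and |t| \<le> 1 merges them.\<close>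

lemma char_exponent_expansion:
  obtains K where "K \<ge> 0"
    "\<And>t. \<bar>t\<bar> \<le> 1 \<Longrightarrow> norm (char_exponent t) \<le> K * \<bar>t\<bar>"
    "\<And>t. \<bar>t\<bar> \<le> 1 \<Longrightarrow> norm (char_exponent t * of_real (zeta_real 2) - char_exponent t ^ 2 * of_real (zeta_real 3) - \<i> * of_real t)
        \<le> K * \<bar>t\<bar> ^ 3"
proof -
  define x y where "x = zeta_real 2" and "y = zeta_real 3"
  have "x \<ge> 1" "y \<ge> 1" using zeta_real_ge_1[of 2] zeta_real_ge_1[of 3] by (simp_all add: x_def y_def)
  define s where "s = y / x ^ 3"
  have s: "s \<ge> 0" using \<open>x \<ge> 1\<close> \<open>y \<ge> 1\<close> by (simp add: s_def)
  have z: "char_exponent t = - of_real (s * t ^ 2) + \<i> * of_real (t / x)" for t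
    by (simp add: char_exponent_def complex_eq_iff s_def x_def y_def)
  have 1: "norm (char_exponent t) \<le> (s + 1 / x) * \<bar>t\<bar>" if "\<bar>t\<bar> \<le> 1" for t
  proof -
    have "norm (char_exponent t) \<le> \<bar>s * t ^ 2\<bar> + \<bar>t / x\<bar>"
      unfolding z by (rule order_trans[OF norm_triangle_ineq]) (simp add: norm_mult norm_divide norm_power abs_mult power_abs)
    also have "\<dots> = s * t ^ 2 + \<bar>t\<bar> / x"
      using s \<open>x \<ge> 1\<close> by simp
    also have "s * t ^ 2 \<le> s * \<bar>t\<bar>"
      using s that power_decreasing[of 1 2 "\<bar>t\<bar>"] by (intro mult_left_mono) auto
    finally show ?thesis using s \<open>x \<ge> 1\<close> by (simp add: algebra_simps)
  qed
  have 2: "norm (char_exponent t * of_real x - char_exponent t ^ 2 * of_real y - \<i> * of_real t)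
      \<le> (2 * s * y / x + s ^ 2 * y) * \<bar>t\<bar> ^ 3" if "\<bar>t\<bar> \<le> 1" for t
  proof -
    have "char_exponent t * of_real x - char_exponent t ^ 2 * of_real y - \<i> * of_real t =
        of_real (y / x ^ 2 - s * x) * of_real (t ^ 2) + \<i> * of_real (2 * s * y / x * t ^ 3)
          - of_real (s ^ 2 * y * t ^ 4)"
      using \<open>x \<ge> 1\<close> unfolding z complex_eq_iff by (simp add: field_simps eval_nat_numeral)
    also have "y / x ^ 2 - s * x = 0"
      using \<open>x \<ge> 1\<close> by (simp add: s_def field_simps eval_nat_numeral)
    finally have "norm (char_exponent t * of_real x - char_exponent t ^ 2 * of_real y - \<i> * of_real t)
        = norm (\<i> * of_real (2 * s * y / x * t ^ 3) - of_real (s ^ 2 * y * t ^ 4) :: complex)"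
      by simp
    also have "\<dots> \<le> \<bar>2 * s * y / x * t ^ 3\<bar> + \<bar>s ^ 2 * y * t ^ 4\<bar>"
      by (rule order_trans[OF norm_triangle_ineq4]) (simp only: norm_mult norm_of_real norm_ii mult_1_left order_refl)
    also have "\<dots> = 2 * s * y / x * \<bar>t\<bar> ^ 3 + s ^ 2 * y * \<bar>t\<bar> ^ 4"
      using s \<open>x \<ge> 1\<close> \<open>y \<ge> 1\<close> by (simp add: abs_mult power_abs)
    also have "s ^ 2 * y * \<bar>t\<bar> ^ 4 \<le> s ^ 2 * y * \<bar>t\<bar> ^ 3"
      using that \<open>y \<ge> 1\<close> by (intro mult_left_mono power_decreasing) auto
    finally show ?thesis by (simp add: algebra_simps)
  qed
  have nonneg: "s + 1 / x \<ge> 0" "2 * s * y / x + s ^ 2 * y \<ge> 0"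
    using s \<open>x \<ge> 1\<close> \<open>y \<ge> 1\<close> by auto
  show ?thesis
  proof (rule that[of "(s + 1 / x) + (2 * s * y / x + s ^ 2 * y)"])
    fix t :: real
    assume t: "\<bar>t\<bar> \<le> 1"
    have "(s + 1 / x) * \<bar>t\<bar> \<le> ((s + 1 / x) + (2 * s * y / x + s ^ 2 * y)) * \<bar>t\<bar>"
      using nonneg by (intro mult_right_mono) auto
    with 1[OF t] show "norm (char_exponent t) \<le> \<dots>" by (rule order_trans)
    have "(2 * s * y / x + s ^ 2 * y) * \<bar>t\<bar> ^ 3
        \<le> ((s + 1 / x) + (2 * s * y / x + s ^ 2 * y)) * \<bar>t\<bar> ^ 3"
      using nonneg by (intro mult_right_mono) auto
    with 2[OF t] show "norm (char_exponent t * of_real (zeta_real 2)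
        - char_exponent t ^ 2 * of_real (zeta_real 3) - \<i> * of_real t) \<le> \<dots>"
      unfolding x_def[symmetric] y_def[symmetric] by (rule order_trans)
  qed (use nonneg in linarith)
qed

lemma Re_char_exponent_le_0: "Re (char_exponent t) \<le> 0"
  using zeta_real_ge_1[of 2] zeta_real_ge_1[of 3] by (simp add: char_exponent_def)

lemma char_exponent_generator:
  obtains K where "K \<ge> 0" "\<And>t n. \<bar>t\<bar> \<le> 1 \<Longrightarrow> n \<ge> 1 \<Longrightarrow>
    norm ((\<Sum>k=1..n. (exp (char_exponent t * of_real (harm n)) - exp (char_exponent t * of_real (harm (n - k)))) / of_nat k)
      - \<i> * of_real t * exp (char_exponent t * of_real (harm n)))
    \<le> K * \<bar>t\<bar> * (harm n / real (Suc n)) + K * \<bar>t\<bar> ^ 3"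
proof -
  obtain K where K: "K \<ge> 0" "\<And>t. \<bar>t\<bar> \<le> 1 \<Longrightarrow> norm (char_exponent t) \<le> K * \<bar>t\<bar>"
    "\<And>t. \<bar>t\<bar> \<le> 1 \<Longrightarrow> norm (char_exponent t * of_real (zeta_real 2) - char_exponent t ^ 2 * of_real (zeta_real 3)
      - \<i> * of_real t) \<le> K * \<bar>t\<bar> ^ 3"
    using char_exponent_expansion by blast
  obtain B where B: "B \<ge> 0" "\<And>n. (\<Sum>k=1..n. 4 * harm k ^ 2 / real k ^ 2) \<le> B"
    using sum_harm_square_bounded by blast
  define L where "L = (2 * K + 3 * K ^ 2) + (K ^ 3 / 2 * B + K)"
  show ?thesis
  proof (rule that[of L])
    show "L \<ge> 0" using K(1) B(1) by (simp add: L_def)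
    fix t :: real and n :: nat
    assume t: "\<bar>t\<bar> \<le> 1" and n: "n \<ge> 1"
    define z E where "z = char_exponent t" and "E = exp (z * of_real (harm n))"
    define A Q C where "A = (\<Sum>k=1..n. (harm n - harm (n - k)) / real k)"
      and "Q = (\<Sum>k=1..n. (harm n - harm (n - k)) ^ 2 / real k)"
      and "C = (\<Sum>k=1..n. (harm n - harm (n - k)) ^ 3 / real k)"
    define S where "S = (\<Sum>k=1..n. (E - exp (z * of_real (harm (n - k)))) / of_nat k)"
    define \<epsilon> where "\<epsilon> = harm n / real (Suc n)"
    have \<epsilon>: "\<epsilon> \<ge> 0" by (simp add: \<epsilon>_def harm_nonneg)
    have z: "norm z \<le> K * \<bar>t\<bar>" using K(2) t by (simp add: z_def)
    have E: "norm E \<le> 1"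
      using Re_char_exponent_le_0[of t] by (simp add: E_def z_def mult_nonpos_nonneg harm_nonneg)
    have "C \<le> B"
      unfolding C_def using sum_harm_diff_3_le B(2) by (rule order_trans)
    have "norm (S - E * (z * of_real A - z ^ 2 / 2 * of_real Q)) \<le> norm z ^ 3 / 2 * C"
      unfolding S_def E_def A_def Q_def C_def
      by (rule norm_generator_exp_harm_le) (simp add: z_def Re_char_exponent_le_0)
    also have "\<dots> \<le> norm z ^ 3 / 2 * B"
      using \<open>C \<le> B\<close> by (intro mult_left_mono) auto
    also have "\<dots> \<le> (K * \<bar>t\<bar>) ^ 3 / 2 * B"
      using z B(1) by (intro mult_right_mono divide_right_mono power_mono) auto
    finally have 1: "norm (S - E * (z * of_real A - z ^ 2 / 2 * of_real Q)) \<le> K ^ 3 / 2 * B * \<bar>t\<bar> ^ 3"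
      by (simp add: power_mult_distrib mult_ac)
    have "norm (z * of_real (A - zeta_real 2)) = norm z * \<bar>A - zeta_real 2\<bar>"
      by (simp only: norm_mult norm_of_real)
    also have "\<dots> \<le> (K * \<bar>t\<bar>) * (2 * \<epsilon>)"
      using harm_moment_errors(1)[OF n] z K(1) by (intro mult_mono) (auto simp: A_def \<epsilon>_def)
    finally have 2: "norm (z * of_real (A - zeta_real 2)) \<le> 2 * K * \<bar>t\<bar> * \<epsilon>" by simp
    have "norm (z ^ 2 / 2 * of_real (Q - 2 * zeta_real 3)) = norm z ^ 2 / 2 * \<bar>Q - 2 * zeta_real 3\<bar>"
      by (simp only: norm_mult norm_of_real norm_divide norm_power norm_numeral)
    also have "\<dots> \<le> (K * \<bar>t\<bar>) ^ 2 / 2 * (6 * \<epsilon>)"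
      using harm_moment_errors(2)[OF n] z K(1)
      by (intro mult_mono divide_right_mono power_mono) (auto simp: Q_def \<epsilon>_def)
    also have "\<dots> = 3 * K ^ 2 * \<bar>t\<bar> ^ 2 * \<epsilon>" by (simp add: power_mult_distrib)
    also have "\<dots> \<le> 3 * K ^ 2 * \<bar>t\<bar> * \<epsilon>"
      using t \<epsilon> power_decreasing[of 1 2 "\<bar>t\<bar>"] by (intro mult_right_mono mult_left_mono) auto
    finally have 3: "norm (z ^ 2 / 2 * of_real (Q - 2 * zeta_real 3)) \<le> 3 * K ^ 2 * \<bar>t\<bar> * \<epsilon>" .
    define r where "r = z * of_real (zeta_real 2) - z ^ 2 * of_real (zeta_real 3) - \<i> * of_real t"
    have 4: "norm r \<le> K * \<bar>t\<bar> ^ 3"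
      using K(3)[OF t] by (simp add: r_def z_def)
    \<comment> \<open>Three sources of error: the Taylor remainder, the moments \<open>A\<close> and
      \<open>Q\<close> against their limits, and the residual \<open>r\<close> of the eigenvalue
      equation. The moments cause the part decaying in n, the other two the uniform cubic
      part.\<close>
    have "S - \<i> * of_real t * E = (S - E * (z * of_real A - z ^ 2 / 2 * of_real Q))
        + E * (z * of_real (A - zeta_real 2) - z ^ 2 / 2 * of_real (Q - 2 * zeta_real 3) + r)"
      by (simp add: r_def algebra_simps)
    also have "norm \<dots> \<le> norm (S - E * (z * of_real A - z ^ 2 / 2 * of_real Q))
        + norm E * norm (z * of_real (A - zeta_real 2) - z ^ 2 / 2 * of_real (Q - 2 * zeta_real 3) + r)"
      by (metis norm_triangle_ineq norm_mult)
    also have "\<dots> \<le> K ^ 3 / 2 * B * \<bar>t\<bar> ^ 3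
        + 1 * (2 * K * \<bar>t\<bar> * \<epsilon> + 3 * K ^ 2 * \<bar>t\<bar> * \<epsilon> + K * \<bar>t\<bar> ^ 3)"
    proof (intro add_mono mult_mono 1 E)
      have "norm (z * of_real (A - zeta_real 2) - z ^ 2 / 2 * of_real (Q - 2 * zeta_real 3) + r)
          \<le> norm (z * of_real (A - zeta_real 2)) + norm (z ^ 2 / 2 * of_real (Q - 2 * zeta_real 3)) + norm r"
        by (intro order_trans[OF norm_triangle_ineq] add_right_mono norm_triangle_ineq4)
      then show "norm (z * of_real (A - zeta_real 2) - z ^ 2 / 2 * of_real (Q - 2 * zeta_real 3) + r)
          \<le> 2 * K * \<bar>t\<bar> * \<epsilon> + 3 * K ^ 2 * \<bar>t\<bar> * \<epsilon> + K * \<bar>t\<bar> ^ 3"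
        using 2 3 4 by linarith
    qed auto
    also have "\<dots> = (2 * K + 3 * K ^ 2) * (\<bar>t\<bar> * \<epsilon>) + (K ^ 3 / 2 * B + K) * \<bar>t\<bar> ^ 3"
      by (simp add: algebra_simps)
    also have "\<dots> \<le> L * (\<bar>t\<bar> * \<epsilon>) + L * \<bar>t\<bar> ^ 3"
    proof (intro add_mono mult_right_mono)
      have "0 \<le> K ^ 3 / 2 * B + K" "0 \<le> 2 * K + 3 * K ^ 2" using K(1) B(1) by simp_all
      then show "2 * K + 3 * K ^ 2 \<le> L" "K ^ 3 / 2 * B + K \<le> L" by (simp_all add: L_def)
    qed (use \<epsilon> in auto)
    finally show "norm ((\<Sum>k=1..n. (exp (char_exponent t * of_real (harm n))
          - exp (char_exponent t * of_real (harm (n - k)))) / of_nat k)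
        - \<i> * of_real t * exp (char_exponent t * of_real (harm n)))
        \<le> L * \<bar>t\<bar> * (harm n / real (Suc n)) + L * \<bar>t\<bar> ^ 3"
      by (simp only: S_def E_def z_def \<epsilon>_def mult.assoc)
  qed
qed

text \<open>Comparison principle: $1 - 1/(n+1)$ and $H_n$ are supersolutions for the two parts of the error.\<close>

lemma harmonic_descent_comparison:
  fixes e \<delta> :: "nat \<Rightarrow> complex" and t \<alpha> \<beta> :: real
  assumes "e 0 = 0" "\<alpha> \<ge> 0" "\<beta> \<ge> 0"
    and rec: "\<And>n. n \<ge> 1 \<Longrightarrow>
      (of_real (harm n) - \<i> * of_real t) * e n = (\<Sum>k=1..n. e (n - k) / of_nat k) + \<delta> n"
    and err: "\<And>n. n \<ge> 1 \<Longrightarrow> norm (\<delta> n) \<le> \<alpha> * (harm n / real (Suc n)) + \<beta>"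
  shows "norm (e n) \<le> \<alpha> * (1 - 1 / real (Suc n)) + \<beta> * harm n"
proof (induction n rule: less_induct)
  case (less n)
  define b where "b m = \<alpha> * (1 - 1 / real (Suc m)) + \<beta> * harm m" for m
  show ?case
  proof (cases "n = 0")
    case True
    then show ?thesis using assms(1) by (simp add: harm_expand)
  next
    case False
    then have n: "n \<ge> 1" by simp
    \<comment> \<open>The operator maps 1 - 1/(n+1) exactly to H_n/(n+1), and H_n to a partial sum
      of zeta(2), which is at least 1. So \<open>b\<close> dominates both parts of the
      error.\<close>
    have "(\<Sum>k=1..n. (b n - b (n - k)) / real k) =
        \<alpha> * (\<Sum>k=1..n. (1 / real (Suc (n - k)) - 1 / real (Suc n)) / real k)
        + \<beta> * (\<Sum>k=1..n. (harm n - harm (n - k)) / real k)"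
      unfolding sum_distrib_left sum.distrib[symmetric] b_def
      by (intro sum.cong refl) (simp add: diff_divide_distrib add_divide_distrib right_diff_distrib)
    also have "(\<Sum>k=1..n. (1 / real (Suc (n - k)) - 1 / real (Suc n)) / real k) =
        (\<Sum>k=1..n. 1 / real (Suc n) * (1 / real (n + 1 - k)))"
    proof (intro sum.cong refl)
      fix k assume k: "k \<in> {1..n}"
      define M r where "M = real (Suc n)" and "r = real (Suc (n - k))"
      have "M > 0" "r > 0" "real k = M - r" "real (n + 1 - k) = r"
        using k by (simp_all add: M_def r_def Suc_diff_le)
      moreover have "real k \<noteq> 0" using k by simp
      ultimately have "(1 / r - 1 / M) / real k = 1 / M * (1 / real (n + 1 - k))"
        by (simp add: diff_frac_eq)
      then show "(1 / real (Suc (n - k)) - 1 / real (Suc n)) / real k = 1 / real (Suc n) * (1 / real (n + 1 - k))"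
        by (simp only: M_def r_def)
    qed
    also have "\<dots> = harm n / real (Suc n)"
      by (simp only: sum_distrib_left[symmetric] sum_inverse_rev) simp
    finally have b: "(\<Sum>k=1..n. (b n - b (n - k)) / real k) =
        \<alpha> * (harm n / real (Suc n)) + \<beta> * (\<Sum>k=1..n. 1 / real k ^ 2)"
      by (simp only: sum_harm_diff_1)
    have "(\<Sum>k=1..1. 1 / real k ^ 2) \<le> (\<Sum>k=1..n. 1 / real k ^ 2)"
      using n by (intro sum_mono2) auto
    then have ge: "\<beta> \<le> \<beta> * (\<Sum>k=1..n. 1 / real k ^ 2)"
      using mult_left_mono[of 1 _ \<beta>] assms(3) by simp
    have H: "harm n > (0::real)" using n by simp
    \<comment> \<open>The imaginary part can only enlarge the modulus, so the complex recursion is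
      dominated by the real one at t = 0.\<close>
    have "harm n \<le> norm (of_real (harm n) - \<i> * of_real t)"
      using abs_Re_le_cmod[of "of_real (harm n) - \<i> * of_real t"] by simp
    then have "harm n * norm (e n) \<le> norm ((of_real (harm n) - \<i> * of_real t) * e n)"
      by (simp add: norm_mult mult_right_mono)
    also have "\<dots> \<le> norm (\<Sum>k=1..n. e (n - k) / of_nat k) + norm (\<delta> n)"
      unfolding rec[OF n] by (rule norm_triangle_ineq)
    also have "\<dots> \<le> (\<Sum>k=1..n. b (n - k) / real k) + (\<alpha> * (harm n / real (Suc n)) + \<beta>)"
    proof (intro add_mono sum_norm_le err n)
      fix k assume "k \<in> {1..n}"
      then have "norm (e (n - k)) \<le> b (n - k)"
        unfolding b_def by (intro less.IH) auto
      then show "norm (e (n - k) / of_nat k) \<le> b (n - k) / real k"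
        by (simp add: norm_divide divide_right_mono)
    qed
    also have "\<dots> \<le> (\<Sum>k=1..n. b (n - k) / real k) + (\<Sum>k=1..n. (b n - b (n - k)) / real k)"
      using b ge by simp
    also have "\<dots> = b n * (\<Sum>k=1..n. 1 / real k)"
      unfolding sum.distrib[symmetric] sum_distrib_left by (intro sum.cong refl) (simp add: diff_divide_distrib)
    also have "\<dots> = harm n * b n"
      by (simp add: sum_inverse_harm)
    finally show ?thesis using H by (simp add: b_def)
  qed
qed

section \<open>Limit of the normalised approximate solution\<close>

text \<open>H_{n-1} = ln n + u_n with u_n bounded. The ln n part of the phase is cancelled exactly
  by the centring, and in the real part it gives the Gaussian exponent. The u_n parts vanish after
  division by sqrt(ln n) and ln n.\<close>

lemma char_exponent_limit:
  "(\<lambda>n. exp (char_exponent (t / sqrt (ln (real n))) * of_real (harm (n - 1)))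
      * iexp (- (t * (1 / zeta_real 2) * sqrt (ln (real n)))))
    \<longlonglongrightarrow> exp (of_real (- (zeta_real 3 / zeta_real 2 ^ 3) * t ^ 2))"
proof -
  define x s where "x = zeta_real 2" and "s = zeta_real 3 / zeta_real 2 ^ 3"
  define \<gamma> where "\<gamma> = (\<lambda>n. harm n - ln (real n))"
  have \<gamma>: "\<gamma> \<longlonglongrightarrow> euler_mascheroni"
    unfolding \<gamma>_def by (rule euler_mascheroni_LIMSEQ)
  define u where "u = (\<lambda>n. \<gamma> n - 1 / real n)"
  have u: "u \<longlonglongrightarrow> euler_mascheroni - 0"
    unfolding u_def by (intro tendsto_diff \<gamma> lim_1_over_n)
  have inv1: "(\<lambda>n. 1 / ln (real n)) \<longlonglongrightarrow> 0" and inv2: "(\<lambda>n. 1 / sqrt (ln (real n))) \<longlonglongrightarrow> 0"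
    by real_asymp+
  have re: "(\<lambda>n. - s * t ^ 2 * (1 + u n * (1 / ln (real n)))) \<longlonglongrightarrow> - s * t ^ 2 * (1 + (euler_mascheroni - 0) * 0)"
    by (intro tendsto_intros u inv1)
  have im: "(\<lambda>n. t / x * (u n * (1 / sqrt (ln (real n))))) \<longlonglongrightarrow> t / x * ((euler_mascheroni - 0) * 0)"
    by (intro tendsto_intros u inv2)
  have "(\<lambda>n. exp (Complex (- s * t ^ 2 * (1 + u n * (1 / ln (real n)))) (t / x * (u n * (1 / sqrt (ln (real n)))))))
      \<longlonglongrightarrow> exp (Complex (- s * t ^ 2 * (1 + (euler_mascheroni - 0) * 0)) (t / x * ((euler_mascheroni - 0) * 0)))"
    by (intro tendsto_exp tendsto_Complex re im)
  moreover have "\<forall>\<^sub>F n in sequentially.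
      exp (Complex (- s * t ^ 2 * (1 + u n * (1 / ln (real n)))) (t / x * (u n * (1 / sqrt (ln (real n)))))) =
      exp (char_exponent (t / sqrt (ln (real n))) * of_real (harm (n - 1)))
        * iexp (- (t * (1 / zeta_real 2) * sqrt (ln (real n))))"
  proof (rule eventually_sequentiallyI[of 2])
    fix n :: nat
    assume n: "2 \<le> n"
    define l where "l = sqrt (ln (real n))"
    have l: "l > 0" "ln (real n) = l ^ 2" using n by (simp_all add: l_def)
    have h: "harm (n - 1) = u n + l ^ 2"
      using n harm_Suc[of "n - 1", where 'a = real]
      by (simp add: u_def \<gamma>_def l(2)[symmetric] inverse_eq_divide)
    have ce: "char_exponent v = Complex (- s * v ^ 2) (v / x)" for v
      by (simp add: char_exponent_def s_def x_def)
    have "char_exponent (t / l) * of_real (u n + l ^ 2) + \<i> * of_real (- (t * (1 / x) * l)) =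
        Complex (- s * t ^ 2 * (1 + u n * (1 / l ^ 2))) (t / x * (u n * (1 / l)))"
      using l(1) zeta_real_ge_1[of 2] unfolding complex_eq_iff ce
      by (simp add: x_def[symmetric] field_simps power2_eq_square)
    then show "exp (Complex (- s * t ^ 2 * (1 + u n * (1 / ln (real n)))) (t / x * (u n * (1 / sqrt (ln (real n)))))) =
      exp (char_exponent (t / sqrt (ln (real n))) * of_real (harm (n - 1)))
        * iexp (- (t * (1 / zeta_real 2) * sqrt (ln (real n))))"
      unfolding exp_add[symmetric] l_def[symmetric] x_def[symmetric] unfolding l(2) h by simp
  qed
  ultimately have "(\<lambda>n. exp (char_exponent (t / sqrt (ln (real n))) * of_real (harm (n - 1)))
        * iexp (- (t * (1 / zeta_real 2) * sqrt (ln (real n)))))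
      \<longlonglongrightarrow> exp (Complex (- s * t ^ 2 * (1 + (euler_mascheroni - 0) * 0)) (t / x * ((euler_mascheroni - 0) * 0)))"
    by (rule Lim_transform_eventually)
  then show ?thesis
    by (simp add: s_def complex_of_real_def)
qed

section \<open>The characteristic functions of the absorption times\<close>

lemma bs_rate_eq_harm: "bs_rate (Suc n) = harm n"
  unfolding bs_rate_def harm_def inverse_eq_divide
  by (rule sum.reindex_bij_witness[of _ "\<lambda>k. Suc n - k" "\<lambda>k. Suc n - k"]) auto

text \<open>The weights define a distribution because they sum to
  \<open>bs_rate (Suc n) = harm n\<close>, which is nonzero for n \<ge> 1; state 1 has no outgoing
  jumps.\<close>

lemma pmf_bs_jump:
  assumes "n \<ge> 1"
  shows "pmf (bs_jump (Suc n)) i =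
    (if 1 \<le> i \<and> i < Suc n then (1 / real (Suc n - i)) / harm n else 0)"
proof -
  define f where "f i = (if 1 \<le> i \<and> i < Suc n then (1 / real (Suc n - i)) / bs_rate (Suc n) else 0)" for i
  have h: "harm n > (0 :: real)" using assms by simp
  have nonneg: "f i \<ge> 0" for i by (simp add: f_def bs_rate_eq_harm harm_nonneg del: of_nat_diff)
  have "(\<integral>\<^sup>+i. ennreal (f i) \<partial>count_space UNIV) = (\<integral>\<^sup>+i. ennreal (f i) \<partial>count_space {1..<Suc n})"
    by (intro nn_integral_count_space_eq) (auto simp: f_def)
  also have "\<dots> = ennreal (\<Sum>i\<in>{1..<Suc n}. f i)"
    using nonneg by (simp add: nn_integral_count_space_finite sum_ennreal del: sum.op_ivl_Suc)
  also have "(\<Sum>i\<in>{1..<Suc n}. f i) = (\<Sum>i\<in>{1..<Suc n}. 1 / real (Suc n - i)) / bs_rate (Suc n)"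
    unfolding sum_divide_distrib by (intro sum.cong) (auto simp: f_def)
  also have "\<dots> = 1"
    using less_imp_neq[OF h] unfolding bs_rate_def[symmetric] by (simp add: bs_rate_eq_harm)
  finally have "(\<integral>\<^sup>+i. ennreal (f i) \<partial>count_space UNIV) = 1" by simp
  with nonneg have "pmf (embed_pmf f) i = f i" by (rule pmf_embed_pmf)
  then show ?thesis
    unfolding bs_jump_def f_def bs_rate_eq_harm by simp
qed

section \<open>Characteristic functions of holding times, independent sums and mixtures\<close>

text \<open>Fundamental theorem of calculus on the half line: the antiderivative is a multiple of
  exp(c x) and decays because Re c = -l < 0.\<close>

lemma char_exponential_density:
  assumes l: "l > 0"
  shows "char (density lborel (exponential_density l)) t = of_real l / (of_real l - \<i> * of_real t)"
proof -
  define c where "c = - of_real l + \<i> * of_real t"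
  have c: "Re c = - l" "c \<noteq> 0" using l by (auto simp: c_def complex_eq_iff)
  define F where "F x = of_real l / c * exp (c * of_real x)" for x :: real
  define f where "f x = of_real l * exp (c * of_real x)" for x :: real
  have int: "integrable lborel (exponential_density l)"
  proof -
    interpret prob_space "density lborel (exponential_density l)"
      using l by (rule prob_space_exponential_density)
    have "integrable (density lborel (exponential_density l)) (\<lambda>_. 1 :: real)" by simp
    then show ?thesis
      using l by (subst (asm) integrable_density) (auto simp: exponential_density_nonneg)
  qed
  have norm_f: "indicator {0<..} x *\<^sub>R f x = indicator {0<..} x *\<^sub>R (of_real (exponential_density l x) * iexp (t * x))" for x
    by (auto simp: f_def c_def exponential_density_def exp_of_real[symmetric] exp_add[symmetric]
        algebra_simps split: split_indicator)
  have "set_integrable lborel {0<..} f"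
    unfolding set_integrable_def
  proof (rule Bochner_Integration.integrable_bound[OF int])
    show "AE x in lborel. norm (indicator {0<..} x *\<^sub>R f x) \<le> norm (exponential_density l x)"
      unfolding norm_f by (auto simp: norm_mult split: split_indicator)
    show "(\<lambda>x. indicator {0<..} x *\<^sub>R f x) \<in> borel_measurable lborel"
      unfolding f_def by measurable
  qed
  moreover have "einterval 0 \<infinity> = {0<..}"
    by (auto simp: einterval_def zero_ereal_def)
  ultimately have int_f: "set_integrable lborel (einterval 0 \<infinity>) f" by simp
  have "(CLBINT x=0..\<infinity>. f x) = 0 - F 0"
  proof (rule interval_integral_FTC_integrable[where F = F])
    show "(F has_vector_derivative f x) (at x)" for x
      unfolding F_def f_def has_real_derivative_iff_has_vector_derivative
      using c(2) by (auto intro!: derivative_eq_intros has_vector_derivative_real_field simp: field_simps)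
    show "isCont f x" for x
      unfolding f_def by (intro continuous_intros)
    show "((F \<circ> real_of_ereal) \<longlongrightarrow> F 0) (at_right 0)"
      unfolding zero_ereal_def ereal_tendsto_simps
      unfolding F_def by (intro tendsto_intros)
    have "((\<lambda>x. l / norm c * exp (- (l * x))) \<longlongrightarrow> 0) at_top"
      using l by real_asymp
    then have "((\<lambda>x. norm (F x)) \<longlongrightarrow> 0) at_top"
      using l by (simp add: F_def norm_mult norm_divide c)
    then show "((F \<circ> real_of_ereal) \<longlongrightarrow> 0) (at_left \<infinity>)"
      unfolding ereal_tendsto_simps by (rule tendsto_norm_zero_cancel)
  qed (use int_f in auto)
  also have "0 - F 0 = of_real l / (of_real l - \<i> * of_real t)"
    unfolding F_def by (simp add: c_def) (metis minus_diff_eq minus_divide_right uminus_add_conv_diff)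
  finally have "(CLBINT x:{0<..}. f x) = of_real l / (of_real l - \<i> * of_real t)"
    by (simp add: interval_lebesgue_integral_def \<open>einterval 0 \<infinity> = {0<..}\<close>)
  moreover have "char (density lborel (exponential_density l)) t = (CLBINT x:{0<..}. f x)"
    unfolding char_def set_lebesgue_integral_def
  proof (subst integral_density)
    show "AE x in lborel. 0 \<le> exponential_density l x" using l by (simp add: exponential_density_nonneg)
    \<comment> \<open>The density equals l at 0, while the open half line omits that point; the
      integrands agree off a null set.\<close>
    have "AE x in lborel. x \<noteq> (0::real)" by (rule AE_lborel_singleton)
    then show "(\<integral>x. exponential_density l x *\<^sub>R iexp (t * x) \<partial>lborel) = (\<integral>x. indicator {0<..} x *\<^sub>R f x \<partial>lborel)"
      unfolding norm_f
      by (intro integral_cong_AE) (auto simp: scaleR_conv_of_real exponential_density_def split: split_indicator)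
  qed auto
  ultimately show ?thesis by simp
qed

lemma char_convolution:
  assumes "real_distribution M" "real_distribution N"
  shows "char (convolution M N) t = char M t * char N t"
proof -
  interpret M: real_distribution M by fact
  interpret N: real_distribution N by fact
  interpret P: pair_prob_space M N ..
  have [measurable_cong]: "sets M = sets borel" "sets N = sets borel" by simp_all
  have int: "integrable (M \<Otimes>\<^sub>M N) (\<lambda>(x, y). iexp (t * (x + y)))"
    by (rule P.P.integrable_const_bound[where B = 1]) (auto simp: split_beta)
  have "char (convolution M N) t = (CLINT p|M \<Otimes>\<^sub>M N. case p of (x, y) \<Rightarrow> iexp (t * (x + y)))"
    unfolding char_def convolution_def by (subst integral_distr) (simp_all add: case_prod_unfold)
  also have "\<dots> = (CLINT x|M. CLINT y|N. iexp (t * (x + y)))"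
    using P.integral_fst'[OF int] by simp
  also have "\<dots> = (CLINT x|M. CLINT y|N. iexp (t * x) * iexp (t * y))"
    by (simp add: exp_add distrib_left)
  also have "\<dots> = char M t * char N t"
    by (simp add: char_def)
  finally show ?thesis .
qed

lemma real_distribution_convolution:
  assumes "real_distribution M" "real_distribution N"
  shows "real_distribution (convolution M N)"
proof -
  interpret M: real_distribution M by fact
  interpret N: real_distribution N by fact
  interpret P: pair_prob_space M N ..
  have [measurable_cong]: "sets M = sets borel" "sets N = sets borel" by simp_all
  have "prob_space (convolution M N)"
    unfolding convolution_def by (rule P.P.prob_space_distr) measurable
  then show ?thesis
    by (simp add: real_distribution_def real_distribution_axioms_def)
qed

lemma
  fixes p :: "nat pmf" and L :: "nat \<Rightarrow> real measure"
  assumes "\<And>i. real_distribution (L i)"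
  shows real_distribution_bind_pmf: "real_distribution (measure_pmf p \<bind> L)"
    and char_bind_pmf: "finite (set_pmf p) \<Longrightarrow>
      char (measure_pmf p \<bind> L) t = (\<Sum>i\<in>set_pmf p. of_real (pmf p i) * char (L i) t)"
proof -
  have L: "prob_space (L i)" "sets (L i) = sets borel" for i
    using assms[of i] by (auto simp: real_distribution_def real_distribution_axioms_def)
  have meas: "L \<in> measurable (measure_pmf p) (subprob_algebra borel)"
    using L by (auto simp: space_subprob_algebra prob_space_imp_subprob_space)
  have sets: "sets (measure_pmf p \<bind> L) = sets borel"
    using L by (intro sets_bind) auto
  have "prob_space (measure_pmf p \<bind> L)"
    using L meas by (intro measure_pmf.prob_space_bind) auto
  with sets show rd: "real_distribution (measure_pmf p \<bind> L)"
    by (simp add: real_distribution_def real_distribution_axioms_def)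
  interpret B: real_distribution "measure_pmf p \<bind> L" by fact
  interpret L: real_distribution "L i" for i by fact
  assume fin: "finite (set_pmf p)"
  have eq: "(\<integral>x. g x \<partial>(measure_pmf p \<bind> L)) = (\<Sum>i\<in>set_pmf p. pmf p i * (\<integral>x. g x \<partial>L i))"
    if g: "g \<in> borel_measurable borel" "\<And>x. \<bar>g x\<bar> \<le> 1" for g :: "real \<Rightarrow> real"
  proof -
    have "(\<integral>x. g x \<partial>(measure_pmf p \<bind> L)) = (\<integral>i. \<integral>x. g x \<partial>L i \<partial>measure_pmf p)"
      using g meas L.emeasure_space_1
      by (intro integral_bind[where K = borel and B = 1 and B' = 1]) (auto simp: measure_pmf.finite_measure_axioms)
    also have "\<dots> = (\<Sum>i\<in>set_pmf p. pmf p i * (\<integral>x. g x \<partial>L i))"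
      using fin by (subst integral_measure_pmf_real[of "set_pmf p"]) (auto simp: mult.commute)
    finally show ?thesis .
  qed
  \<comment> \<open>The mixture formula \<open>eq\<close> concerns real integrands bounded by 1;
    cosine and sine reduce the complex exponential to it.\<close>
  have *: "char M t = Complex (\<integral>x. cos (t * x) \<partial>M) (\<integral>x. sin (t * x) \<partial>M)" if "real_distribution M" for M
  proof -
    interpret M: real_distribution M by fact
    have "integrable M (\<lambda>x. iexp (t * x))"
      by (rule M.integrable_const_bound[where B = 1]) auto
    then show ?thesis
      by (simp add: char_def complex_eq_iff integral_Re[symmetric] integral_Im[symmetric] Re_exp Im_exp
          del: integral_Re integral_Im)
  qed
  show "char (measure_pmf p \<bind> L) t = (\<Sum>i\<in>set_pmf p. of_real (pmf p i) * char (L i) t)"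
    unfolding *[OF rd] *[OF assms] by (subst (1 2) eq) (auto simp: complex_eq_iff)
qed

section \<open>From the staged construction of the laws to the recursion\<close>

text \<open>Stage \<open>Suc m\<close> overwrites only entry \<open>m + 2\<close>, so the entries up
  to \<open>k + 1\<close> are final from stage \<open>k\<close> on.\<close>

lemma bs_laws_stable: "i \<le> Suc k \<Longrightarrow> i \<le> n \<Longrightarrow> k \<le> n \<Longrightarrow> bs_laws n i = bs_laws k i"
  by (induction n) (auto simp: le_Suc_eq)

lemma real_distribution_exponential:
  "l > 0 \<Longrightarrow> real_distribution (density lborel (exponential_density l))"
  using prob_space_exponential_density
  by (auto simp: real_distribution_def real_distribution_axioms_def)

lemma real_distribution_bs_laws: "real_distribution (bs_laws k i)"
proof (induction k arbitrary: i)
  case 0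
  then show ?case
    by (auto simp: real_distribution_def real_distribution_axioms_def intro: prob_space_return)
next
  case (Suc k)
  have "bs_rate (k + 2) > 0"
    using bs_rate_eq_harm[of "Suc k"] by simp
  then show ?case
    using Suc by (auto simp: bs_step_def intro!: real_distribution_convolution real_distribution_bind_pmf
      real_distribution_exponential)
qed

lemma real_distribution_D_law: "real_distribution (D_law n)"
  by (simp add: D_law_def real_distribution_bs_laws)

lemma char_D_law_1: "char (D_law (Suc 0)) t = 1"
  by (simp add: D_law_def char_def integral_return)

text \<open>Entry \<open>Suc n\<close> is set in stage \<open>n\<close> from the laws of stage
  \<open>n - 1\<close>; stage \<open>Suc n\<close> leaves it unchanged.\<close>

lemma D_law_step:
  assumes "n \<ge> 1"
  shows "D_law (Suc n) = bs_step (Suc n) (bs_laws (n - 1))"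
proof -
  obtain k where n: "n = Suc k" using assms by (cases n) auto
  show ?thesis
    by (simp add: D_law_def n)
qed

text \<open>The numerator H_n of the exponential transform cancels the normalisation 1/H_n of the
  jump probabilities.\<close>

lemma char_D_law_rec:
  assumes "n \<ge> 1"
  shows "(of_real (harm n) - \<i> * of_real t) * char (D_law (Suc n)) t =
    (\<Sum>k=1..n. char (D_law (Suc (n - k))) t / of_nat k)"
proof -
  have h: "harm n > (0 :: real)" using assms by simp
  then have h0: "harm n \<noteq> (0 :: real)" by linarith
  then have nz: "of_real (harm n) - \<i> * of_real t \<noteq> 0"
    by (simp add: complex_eq_iff)
  have set: "set_pmf (bs_jump (Suc n)) = {1..n}"
    using h0 by (auto simp: set_pmf_eq pmf_bs_jump[OF assms])
  \<comment> \<open>\<open>D_law i\<close> is read at stage \<open>i\<close>. For i = n this is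
    later than stage \<open>n - 1\<close>, so stability is used in the other direction.\<close>
  have law: "bs_laws (n - 1) i = D_law i" if "i \<in> {1..n}" for i
    unfolding D_law_def
    using that by (cases "i \<le> n - 1") (auto intro: bs_laws_stable bs_laws_stable[symmetric])
  have "char (D_law (Suc n)) t = of_real (harm n) / (of_real (harm n) - \<i> * of_real t) *
      (\<Sum>i\<in>{1..n}. of_real (1 / real (Suc n - i) / harm n) * char (bs_laws (n - 1) i) t)"
    using h unfolding D_law_step[OF assms] bs_step_def bs_rate_eq_harm
    by (subst char_convolution)
       (simp_all add: real_distribution_exponential real_distribution_bind_pmf real_distribution_bs_laws
         char_exponential_density char_bind_pmf set pmf_bs_jump[OF assms])
  also have "(\<Sum>i\<in>{1..n}. of_real (1 / real (Suc n - i) / harm n) * char (bs_laws (n - 1) i) t) =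
      (\<Sum>i\<in>{1..n}. char (D_law i) t / of_nat (Suc n - i)) / of_real (harm n)"
    unfolding sum_divide_distrib by (intro sum.cong refl, subst law) simp_all
  also have "(\<Sum>i\<in>{1..n}. char (D_law i) t / of_nat (Suc n - i)) =
      (\<Sum>k=1..n. char (D_law (Suc (n - k))) t / of_nat k)"
    by (rule sum.reindex_bij_witness[of _ "\<lambda>k. Suc n - k" "\<lambda>k. Suc n - k"]) (auto simp: Suc_diff_le)
  finally show ?thesis using h0 nz by simp
qed

text \<open>The true characteristic function solves the recursion exactly, so the difference
  \<open>e\<close> solves it with the residual of the approximate solution as source. It starts at
  0, since D_1 = 0 and H_0 = 0.\<close>

lemma char_D_law_approx:
  obtains K where "K \<ge> 0" "\<And>t n. \<bar>t\<bar> \<le> 1 \<Longrightarrow>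
    norm (exp (char_exponent t * of_real (harm n)) - char (D_law (Suc n)) t)
      \<le> K * \<bar>t\<bar> + K * \<bar>t\<bar> ^ 3 * harm n"
proof -
  obtain K where K: "K \<ge> 0" "\<And>t n. \<bar>t\<bar> \<le> 1 \<Longrightarrow> n \<ge> 1 \<Longrightarrow>
    norm ((\<Sum>k=1..n. (exp (char_exponent t * of_real (harm n)) - exp (char_exponent t * of_real (harm (n - k)))) / of_nat k)
      - \<i> * of_real t * exp (char_exponent t * of_real (harm n)))
    \<le> K * \<bar>t\<bar> * (harm n / real (Suc n)) + K * \<bar>t\<bar> ^ 3"
    using char_exponent_generator by blast
  show ?thesis
  proof (rule that[OF K(1)])
    fix t :: real and n :: nat
    assume t: "\<bar>t\<bar> \<le> 1"
    define f where "f m = exp (char_exponent t * of_real (harm m))" for m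
    define e where "e m = f m - char (D_law (Suc m)) t" for m
    define \<delta> where "\<delta> m = (\<Sum>k=1..m. (f m - f (m - k)) / of_nat k) - \<i> * of_real t * f m" for m
    have "norm (e n) \<le> K * \<bar>t\<bar> * (1 - 1 / real (Suc n)) + K * \<bar>t\<bar> ^ 3 * harm n"
    proof (rule harmonic_descent_comparison[where \<delta> = \<delta> and t = t])
      show "e 0 = 0" by (simp add: e_def f_def char_D_law_1 harm_expand)
      show "norm (\<delta> m) \<le> K * \<bar>t\<bar> * (harm m / real (Suc m)) + K * \<bar>t\<bar> ^ 3" if "m \<ge> 1" for m
        using K(2)[OF t that] by (simp only: \<delta>_def f_def)
      show "(of_real (harm m) - \<i> * of_real t) * e m = (\<Sum>k=1..m. e (m - k) / of_nat k) + \<delta> m"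
        if "m \<ge> 1" for m
      proof -
        have "of_real (harm m) * f m = (\<Sum>k=1..m. f m / of_nat k)"
          by (simp add: sum_inverse_harm[symmetric] sum_distrib_right)
        moreover have "(\<Sum>k=1..m. (f m - f (m - k)) / of_nat k) =
            (\<Sum>k=1..m. f m / of_nat k) - (\<Sum>k=1..m. f (m - k) / of_nat k)"
          by (simp add: diff_divide_distrib sum_subtractf)
        moreover have "(\<Sum>k=1..m. e (m - k) / of_nat k) = (\<Sum>k=1..m. f (m - k) / of_nat k)
            - (\<Sum>k=1..m. char (D_law (Suc (m - k))) t / of_nat k)"
          by (simp add: e_def diff_divide_distrib sum_subtractf)
        ultimately show ?thesis
          using char_D_law_rec[OF that, of t] unfolding \<delta>_def e_def right_diff_distrib
          by (simp add: left_diff_distrib)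
      qed
    qed (use K(1) in auto)
    also have "\<dots> \<le> K * \<bar>t\<bar> * 1 + K * \<bar>t\<bar> ^ 3 * harm n"
      using K(1) by (intro add_right_mono mult_left_mono) auto
    finally show "norm (exp (char_exponent t * of_real (harm n)) - char (D_law (Suc n)) t)
        \<le> K * \<bar>t\<bar> + K * \<bar>t\<bar> ^ 3 * harm n"
      by (simp add: e_def f_def)
  qed
qed

section \<open>Affine normalisation and the normal limit\<close>

lemma char_distr_affine:
  assumes "real_distribution M"
  shows "char (distr M borel (\<lambda>x. a * x + b)) t = char M (a * t) * iexp (t * b)"
proof -
  interpret real_distribution M by fact
  have "char (distr M borel (\<lambda>x. a * x + b)) t = (CLINT x|M. iexp (a * t * x) * iexp (t * b))"
    unfolding char_def
    by (subst integral_distr) (simp_all add: exp_add[symmetric] algebra_simps)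
  then show ?thesis by (simp add: char_def)
qed

lemma char_normal_distribution:
  assumes "\<sigma> > 0"
  shows "char (density lborel (normal_density 0 \<sigma>)) t = of_real (exp (- (\<sigma> ^ 2 * t ^ 2) / 2))"
proof -
  interpret real_distribution std_normal_distribution by (rule real_dist_normal_dist)
  have "distributed std_normal_distribution lborel (\<lambda>x. x) std_normal_density"
    by (simp add: distributed_def distr_id2)
  then have "distributed std_normal_distribution lborel (\<lambda>x. 0 + \<sigma> * x) (normal_density (0 + \<sigma> * 0) (\<bar>\<sigma>\<bar> * 1))"
    using assms by (intro normal_density_affine) auto
  then have "distr std_normal_distribution lborel (\<lambda>x. \<sigma> * x + 0) = density lborel (normal_density 0 \<sigma>)"
    using assms by (simp add: distributed_def)
  moreover have "distr std_normal_distribution lborel (\<lambda>x. \<sigma> * x + 0) =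
      distr std_normal_distribution borel (\<lambda>x. \<sigma> * x + 0)"
    by (intro distr_cong) auto
  ultimately show ?thesis
    using char_distr_affine[OF real_dist_normal_dist, of \<sigma> 0 t]
    by (simp add: char_std_normal_distribution power_mult_distrib)
qed

theorem theorem13p6:
  fixes \<mu> \<sigma>2 :: real
  assumes "\<mu> = 1 / zeta_real 2"
      and "\<sigma>2 = 2 * zeta_real 3 / (zeta_real 2) ^ 3"
  shows "weak_conv_m
           (\<lambda>n. distr (D_law n) borel (\<lambda>x. (x - \<mu> * ln (real n)) / sqrt (ln (real n))))
           (density lborel (normal_density 0 (sqrt \<sigma>2)))"
proof (rule levy_continuity)
  have "\<sigma>2 > 0"
    using assms(2) zeta_real_ge_1[of 2] zeta_real_ge_1[of 3] by simp
  then show "real_distribution (density lborel (normal_density 0 (sqrt \<sigma>2)))"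
    using prob_space_normal_density[of "sqrt \<sigma>2" 0]
    by (auto simp: real_distribution_def real_distribution_axioms_def)
  define M where "M n = distr (D_law n) borel (\<lambda>x. (x - \<mu> * ln (real n)) / sqrt (ln (real n)))" for n
  have "real_distribution (M n)" for n
  proof -
    interpret real_distribution "D_law n" by (rule real_distribution_D_law)
    show ?thesis unfolding M_def by (rule real_distribution_distr) measurable
  qed
  then show "real_distribution (distr (D_law n) borel (\<lambda>x. (x - \<mu> * ln (real n)) / sqrt (ln (real n))))" for n
    by (simp only: M_def)
  show "(\<lambda>n. char (distr (D_law n) borel (\<lambda>x. (x - \<mu> * ln (real n)) / sqrt (ln (real n)))) t)
      \<longlonglongrightarrow> char (density lborel (normal_density 0 (sqrt \<sigma>2))) t" for t
  proof -
    define \<theta> where "\<theta> n = t / sqrt (ln (real n))" for n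
    define w where "w n = iexp (- (t * (1 / zeta_real 2) * sqrt (ln (real n))))" for n
    define f where "f n = exp (char_exponent (\<theta> n) * of_real (harm (n - 1)))" for n
    have char_M: "char (M n) t = char (D_law n) (\<theta> n) * w n" if "n \<ge> 2" for n
    proof -
      define l where "l = sqrt (ln (real n))"
      have l: "l > 0" "ln (real n) = l ^ 2" using that by (simp_all add: l_def)
      \<comment> \<open>As ln n = l^2, the centring \<mu> ln n divided by l becomes \<mu> l.\<close>
      have "M n = distr (D_law n) borel (\<lambda>x. 1 / l * x + - (\<mu> * l))"
        unfolding M_def l_def[symmetric] unfolding l(2) using l(1)
        by (simp add: field_simps power2_eq_square)
      then have "char (M n) t = char (D_law n) (1 / l * t) * iexp (t * - (\<mu> * l))"
        by (simp only: char_distr_affine[OF real_distribution_D_law])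
      then show ?thesis
        by (simp add: \<theta>_def w_def l_def assms(1))
    qed
    have \<theta>: "\<theta> \<longlonglongrightarrow> 0" unfolding \<theta>_def by real_asymp
    obtain K where K: "K \<ge> 0" "\<And>t n. \<bar>t\<bar> \<le> 1 \<Longrightarrow>
      norm (exp (char_exponent t * of_real (harm n)) - char (D_law (Suc n)) t)
        \<le> K * \<bar>t\<bar> + K * \<bar>t\<bar> ^ 3 * harm n"
      using char_D_law_approx by blast
    have "(\<lambda>n. f n * w n - char (M n) t) \<longlonglongrightarrow> 0"
    proof (rule Lim_null_comparison)
      \<comment> \<open>The cubic error meets its accumulation factor here: (ln n)^(-3/2) against ln
        n leaves order (ln n)^(-1/2). The factor \<open>w n\<close> has modulus 1 and does not
        affect the bound.\<close>
      show "(\<lambda>n. K * \<bar>\<theta> n\<bar> + K * \<bar>t\<bar> ^ 3 * ((ln (real n) + 1) / sqrt (ln (real n)) ^ 3)) \<longlonglongrightarrow> 0"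
      proof -
        have "(\<lambda>n. (ln (real n) + 1) / sqrt (ln (real n)) ^ 3) \<longlonglongrightarrow> 0" by real_asymp
        then have "(\<lambda>n. K * \<bar>\<theta> n\<bar> + K * \<bar>t\<bar> ^ 3 * ((ln (real n) + 1) / sqrt (ln (real n)) ^ 3))
            \<longlonglongrightarrow> K * \<bar>0\<bar> + K * \<bar>t\<bar> ^ 3 * 0"
          by (intro tendsto_intros \<theta>)
        then show ?thesis by simp
      qed
      have "\<forall>\<^sub>F n in sequentially. \<bar>\<theta> n\<bar> < 1"
        using tendsto_rabs_zero[OF \<theta>] by (rule order_tendstoD) simp
      then show "\<forall>\<^sub>F n in sequentially. norm (f n * w n - char (M n) t)
          \<le> K * \<bar>\<theta> n\<bar> + K * \<bar>t\<bar> ^ 3 * ((ln (real n) + 1) / sqrt (ln (real n)) ^ 3)"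
        using eventually_ge_at_top[of 2]
      proof eventually_elim
        case (elim n)
        have "f n * w n - char (M n) t = (f n - char (D_law n) (\<theta> n)) * w n"
          using elim by (simp add: char_M left_diff_distrib)
        then have "norm (f n * w n - char (M n) t) = norm (f n - char (D_law n) (\<theta> n))"
          by (simp add: norm_mult w_def del: of_real_minus of_real_mult)
        also have "\<dots> \<le> K * \<bar>\<theta> n\<bar> + K * \<bar>\<theta> n\<bar> ^ 3 * harm (n - 1)"
          using K(2)[of "\<theta> n" "n - 1"] elim by (simp add: f_def)
        also have "harm (n - 1) \<le> ln (real n) + 1"
          using harm_mono[of "n - 1" n, where 'a = real] harm_le_ln[of n] elim by linarith
        then have "K * \<bar>\<theta> n\<bar> + K * \<bar>\<theta> n\<bar> ^ 3 * harm (n - 1)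
            \<le> K * \<bar>\<theta> n\<bar> + K * \<bar>\<theta> n\<bar> ^ 3 * (ln (real n) + 1)"
          using K(1) by (intro add_left_mono mult_left_mono) auto
        also have "\<bar>\<theta> n\<bar> ^ 3 = \<bar>t\<bar> ^ 3 / sqrt (ln (real n)) ^ 3"
          using elim by (simp add: \<theta>_def power_divide)
        finally show ?case by simp
      qed
    qed
    moreover have "(\<lambda>n. f n * w n) \<longlonglongrightarrow> exp (of_real (- (zeta_real 3 / zeta_real 2 ^ 3) * t ^ 2))"
      unfolding f_def w_def \<theta>_def by (rule char_exponent_limit)
    ultimately have "(\<lambda>n. f n * w n - (f n * w n - char (M n) t))
        \<longlonglongrightarrow> exp (of_real (- (zeta_real 3 / zeta_real 2 ^ 3) * t ^ 2)) - 0"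
      by (intro tendsto_diff)
    moreover have "char (density lborel (normal_density 0 (sqrt \<sigma>2))) t
        = exp (of_real (- (zeta_real 3 / zeta_real 2 ^ 3) * t ^ 2))"
      unfolding exp_of_real using \<open>\<sigma>2 > 0\<close> by (simp add: char_normal_distribution assms(2))
    ultimately show ?thesis by (simp add: M_def)
  qed
qed

end
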